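(* Let $\Sigma\subset\mathbb{R}^3$ be an immersed rotationally symmetric self-shrinking torus. Let $F(\Sigma)$ be the entropy of $\Sigma$, and let $r$ be the distance from the axis of rotation. Then $$F(\Sigma)\ge\pi\min_\Sigma r^2e^{-|x|^2/4}.$$ Moreover, if $r^2e^{-|x|^2/4}$ is not constant on $\Sigma$, then the inequality is strict, that is, $F(\Sigma)>\pi\min_\Sigma r^2e^{-|x|^2/4}$.
   Context: $x$ is the position vector in $\mathbb{R}^3$, with cylindrical coordinates $(r,\theta,z)$ and $|x|^2=r^2+z^2$. For an immersed oriented surface with unit normal $\mathbf{n}$, the second fundamental form is $A(v,w)=\langle\nabla_vw,\mathbf{n}\rangle$ and the mean curvature is $H_\Sigma=-\operatorname{tr}A$. A surface $\Sigma$ is a self-shrinker if $\sqrt{-t}\,\Sigma$, $t<0$, evolves by mean curvature flow $\dot x=-H_\Sigma\mathbf{n}$; equivalently $H_\Sigma=\frac12\langle x,\mathbf{n}\rangle$. A rotationally symmetric torus is generated by rotating, about the axis $\{r=0\}$, an immersed closed curve $\Gamma$ in the open half-plane $\{(r,z):r>0\}$. The $F$-functional is $F(\Sigma)=\frac1{4\pi}\int_\Sigma e^{-|x|^2/4}$; the entropy is $\sup_{x_0\in\mathbb{R}^3,\,t_0>0}F(x_0+\sqrt{t_0}\,\Sigma)$, which for a self-shrinker equals $F(\Sigma)$. *)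

theory Defs
  imports "HOL-Analysis.Analysis"
begin

text \<open>
  A surface is given by an immersion \<open>X\<close> of the parameter plane; a closed surface such as a torus
  is given by a doubly periodic immersion of the plane, i.e. by its lift to the universal cover.
  Pairs are used for the parameters; the type \<open>2\<close> indexes the two coordinate directions.
\<close>

definition coord_dir :: "2 \<Rightarrow> real \<times> real" where
  "coord_dir i = (if i = 1 then (1, 0) else (0, 1))"

definition partial_deriv :: "2 \<Rightarrow> (real \<times> real \<Rightarrow> 'a::real_normed_vector) \<Rightarrow> real \<times> real \<Rightarrow> 'a" where
  "partial_deriv i f p = vector_derivative (\<lambda>t. f (p + t *\<^sub>R coord_dir i)) (at 0)"

definition first_fundamental_form :: "(real \<times> real \<Rightarrow> real^3) \<Rightarrow> real \<times> real \<Rightarrow> real^2^2" where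
  "first_fundamental_form X p = (\<chi> i j. partial_deriv i X p \<bullet> partial_deriv j X p)"

definition unit_normal :: "(real \<times> real \<Rightarrow> real^3) \<Rightarrow> real \<times> real \<Rightarrow> real^3" where
  "unit_normal X p = sgn (cross3 (partial_deriv 1 X p) (partial_deriv 2 X p))"

text \<open>
  The coefficients of \<open>A(v,w) = \<langle>\<nabla>\<^sub>v w, n\<rangle>\<close> on the coordinate fields: the derivative of
  \<open>\<partial>\<^sub>j X\<close> in the direction \<open>\<partial>\<^sub>i X\<close> is \<open>\<partial>\<^sub>i \<partial>\<^sub>j X\<close>.
\<close>

definition second_fundamental_form :: "(real \<times> real \<Rightarrow> real^3) \<Rightarrow> real \<times> real \<Rightarrow> real^2^2" where
  "second_fundamental_form X p =
     (\<chi> i j. partial_deriv i (partial_deriv j X) p \<bullet> unit_normal X p)"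

text \<open>
  The trace of the bilinear form \<open>A\<close> is taken with respect to the induced metric \<open>g\<close>, so it is
  the trace of the matrix \<open>g\<^sup>-\<^sup>1 A\<close>. With this sign a round sphere has positive mean curvature with
  respect to the outward normal.
\<close>

definition mean_curvature :: "(real \<times> real \<Rightarrow> real^3) \<Rightarrow> real \<times> real \<Rightarrow> real" where
  "mean_curvature X p =
     - trace (matrix_inv (first_fundamental_form X p) ** second_fundamental_form X p)"

definition self_shrinker :: "(real \<times> real \<Rightarrow> real^3) \<Rightarrow> bool" where
  "self_shrinker X \<longleftrightarrow> (\<forall>p. mean_curvature X p = 1/2 * (X p \<bullet> unit_normal X p))"

text \<open>
  \<open>D\<close> is a fundamental domain of the parametrization, so that the surface is integrated over exactly
  once, counted with the multiplicity of the immersion; \<open>sqrt (det g)\<close> is the area density.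
\<close>

definition F_functional :: "(real \<times> real) set \<Rightarrow> (real \<times> real \<Rightarrow> real^3) \<Rightarrow> real" where
  "F_functional D X = 1 / (4 * pi) *
     integral D (\<lambda>p. exp (- (norm (X p))\<^sup>2 / 4) * sqrt (det (first_fundamental_form X p)))"

definition entropy :: "(real \<times> real) set \<Rightarrow> (real \<times> real \<Rightarrow> real^3) \<Rightarrow> ereal" where
  "entropy D X =
     (SUP (x\<^sub>0, t\<^sub>0) \<in> UNIV \<times> {0<..}. ereal (F_functional D (\<lambda>p. x\<^sub>0 + sqrt t\<^sub>0 *\<^sub>R X p)))"

definition smooth_curve :: "(real \<Rightarrow> 'a::real_normed_vector) \<Rightarrow> bool" where
  "smooth_curve \<gamma> \<longleftrightarrow>
     (\<forall>n t. ((\<lambda>f s. vector_derivative f (at s)) ^^ n) \<gamma> differentiable at t)"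

text \<open>
  An immersion of the circle of length \<open>T\<close>, as a periodic curve on the line; \<open>T\<close> need not be the
  least period.
\<close>

definition immersed_closed_curve :: "(real \<Rightarrow> 'a::real_normed_vector) \<Rightarrow> real \<Rightarrow> bool" where
  "immersed_closed_curve \<gamma> T \<longleftrightarrow>
     T > 0 \<and> smooth_curve \<gamma> \<and> (\<forall>t. \<gamma> (t + T) = \<gamma> t) \<and> (\<forall>t. vector_derivative \<gamma> (at t) \<noteq> 0)"

text \<open>
  The half-plane has coordinates \<open>(r, z)\<close>, the axis of rotation is the third coordinate axis, and the
  parameters of the surface are the curve parameter and the angle.
\<close>

definition revolution :: "(real \<Rightarrow> real \<times> real) \<Rightarrow> real \<times> real \<Rightarrow> real^3" where
  "revolution \<gamma> = (\<lambda>(t, \<theta>). vector [fst (\<gamma> t) * cos \<theta>, fst (\<gamma> t) * sin \<theta>, snd (\<gamma> t)])"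

definition torus_domain :: "real \<Rightarrow> (real \<times> real) set" where
  "torus_domain T = {0..T} \<times> {0..2 * pi}"

definition axis_dist :: "real^3 \<Rightarrow> real" where
  "axis_dist x = sqrt ((x $ 1)\<^sup>2 + (x $ 2)\<^sup>2)"

end

theory Submission
  imports Defs
begin

text \<open>
  Write the profile curve as \<open>(r, z)\<close>, with speed \<open>v\<close>, weighted density \<open>E = r exp (- (r\<^sup>2 + z\<^sup>2) / 4)\<close>
  and support function \<open>h = (z r' - r z') / v\<close>. Integrating over the angle gives
  \<open>F = 1/2 \<integral> E v\<close>, so \<open>F\<close> is half the length of the profile in the conformal metric of
  density \<open>E\<close>, for which the profiles of self-shrinkers are the geodesics. The function
  \<open>w = r\<^sup>2 exp (- |x|\<^sup>2 / 4)\<close> is \<open>E r\<close>.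

  Dilating a self-shrinker is a variation with eigenvalue \<open>1\<close> of the stability operator, and the
  corresponding function on the profile is \<open>f = E h\<close>. In terms of the arc length \<open>\<sigma>\<close> of the
  conformal metric its equation is \<open>f'' + f / w\<^sup>2 = 0\<close>. Even better, \<open>f' = z / r\<close>: the shrinker
  equation gives the first-order system
  \<open>f' = p\<close>, \<open>p' = - f / w\<^sup>2\<close> for \<open>f = E h\<close> and \<open>p = z / r\<close> (\<open>shrinker_profile_system\<close>).

  Now let \<open>m\<close> be the minimum of \<open>w\<close>. The point \<open>m p + i f\<close> runs through a closed curve that
  avoids the origin, and it always turns in the positive direction, at a rate of at most
  \<open>1 / m\<close> per unit of \<open>\<sigma>\<close>. It therefore makes at least one full turn, which takes
  length at least \<open>2 \<pi> m\<close>; this Sturm comparison is \<open>periodic_solution_length\<close>. Hence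
  \<open>F \<ge> \<pi> m\<close>. Equality forces \<open>f = 0\<close> wherever \<open>w > m\<close>, hence \<open>p = 0\<close> there as well, which the
  uniqueness theorem for linear equations excludes unless \<open>w = m\<close> throughout.
\<close>

section \<open>Closed solutions of a planar linear system\<close>

text \<open>
  Gronwall's argument: if \<open>C\<close> bounds \<open>|a - b|\<close>, then \<open>(f\<^sup>2 + p\<^sup>2) exp (- C t)\<close> is nonincreasing.
  A closed solution that vanishes at some time is followed from there around its whole period.
\<close>

lemma linear_system_unique_forward:
  fixes f p a b :: "real \<Rightarrow> real"
  assumes f': "\<And>t. (f has_real_derivative a t * p t) (at t)"
    and p': "\<And>t. (p has_real_derivative - b t * f t) (at t)"
    and cont: "continuous_on UNIV a" "continuous_on UNIV b"
    and zero: "f s = 0" "p s = 0" and st: "s \<le> t"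
  shows "f t = 0 \<and> p t = 0"
proof -
  have "compact ((\<lambda>x. a x - b x) ` {s..t})"
    by (intro compact_continuous_image continuous_intros
        continuous_on_subset[OF cont(1)] continuous_on_subset[OF cont(2)]) auto
  then obtain C where C: "\<And>x. x \<in> {s..t} \<Longrightarrow> \<bar>a x - b x\<bar> \<le> C"
    using compact_imp_bounded[THEN bounded_iff[THEN iffD1]] by fastforce
  define N where "N = (\<lambda>x. ((f x)\<^sup>2 + (p x)\<^sup>2) * exp (- C * x))"
  have "N t \<le> N s"
  proof (rule DERIV_nonpos_imp_nonincreasing[OF st])
    fix x assume x: "s \<le> x" "x \<le> t"
    have "(N has_real_derivative
        (2 * f x * p x * (a x - b x) - C * ((f x)\<^sup>2 + (p x)\<^sup>2)) * exp (- C * x)) (at x)"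
      unfolding N_def
      by (rule derivative_eq_intros f' p' refl | simp add: algebra_simps power2_eq_square)+
    moreover have "2 * f x * p x * (a x - b x) \<le> C * ((f x)\<^sup>2 + (p x)\<^sup>2)"
    proof -
      have 1: "\<bar>2 * f x * p x\<bar> \<le> (f x)\<^sup>2 + (p x)\<^sup>2"
        using sum_squares_bound[of "f x" "p x"] sum_squares_bound[of "- f x" "p x"] by simp
      have "2 * f x * p x * (a x - b x) \<le> \<bar>2 * f x * p x\<bar> * \<bar>a x - b x\<bar>"
        by (metis abs_ge_self abs_mult)
      also have "\<dots> \<le> ((f x)\<^sup>2 + (p x)\<^sup>2) * C"
        using x by (intro mult_mono 1 C) auto
      finally show ?thesis by (simp add: mult.commute)
    qed
    ultimately show "\<exists>y. (N has_real_derivative y) (at x) \<and> y \<le> 0"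
      by (metis diff_le_0_iff_le exp_ge_zero mult_nonpos_nonneg)
  qed
  then have "(f t)\<^sup>2 + (p t)\<^sup>2 \<le> 0"
    using zero by (simp add: N_def mult_le_0_iff)
  then show ?thesis
    by (simp add: sum_power2_le_zero_iff)
qed

lemma has_vector_derivative_imp_continuous_on:
  assumes "\<And>t. t \<in> S \<Longrightarrow> (f has_vector_derivative f' t) (at t)"
  shows "continuous_on S f"
  using assms has_derivative_continuous
  unfolding has_vector_derivative_def by (blast intro: continuous_at_imp_continuous_on)

text \<open>
  This is integrality of the winding number about the origin: \<open>Z\<close> times the exponential of
  \<open>- \<integral> Z' / Z\<close> is constant, so that for closed \<open>Z\<close> the integral over a period is a multiple
  of \<open>2 \<pi> i\<close>.
\<close>

lemma closed_path_angle:
  fixes Z Z' :: "real \<Rightarrow> complex"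
  assumes "0 < T"
    and deriv: "\<And>t. t \<in> {0..T} \<Longrightarrow> (Z has_vector_derivative Z' t) (at t)"
    and cont: "continuous_on {0..T} Z'"
    and nz: "\<And>t. t \<in> {0..T} \<Longrightarrow> Z t \<noteq> 0"
    and closed: "Z T = Z 0"
  shows "\<exists>n::int. integral {0..T} (\<lambda>t. Im (Z' t / Z t)) = 2 * pi * n"
proof -
  have contZ: "continuous_on {0..T} Z"
    using deriv by (rule has_vector_derivative_imp_continuous_on)
  then have contq: "continuous_on {0..T} (\<lambda>t. Z' t / Z t)"
    using nz by (intro continuous_intros cont) auto
  define G where "G = (\<lambda>t. integral {0..t} (\<lambda>t. Z' t / Z t))"
  have G': "(G has_vector_derivative Z' t / Z t) (at t within {0..T})" if "t \<in> {0..T}" for t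
    unfolding G_def by (rule integral_has_vector_derivative[OF contq that])
  define W where "W = (\<lambda>t. exp (- G t) * Z t)"
  have "(W has_vector_derivative 0) (at t within {0..T})" if t: "t \<in> {0..T}" for t
  proof -
    have e: "((\<lambda>t. exp (- G t)) has_vector_derivative (- (Z' t / Z t)) * exp (- G t)) (at t within {0..T})"
      using field_vector_diff_chain_within[OF has_vector_derivative_minus[OF G'[OF t]], of exp "exp (- G t)"]
      by (simp add: o_def DERIV_exp has_field_derivative_at_within)
    show ?thesis
      unfolding W_def
      using has_vector_derivative_mult[OF e has_vector_derivative_at_within[OF deriv[OF t]]] nz[OF t]
      by (simp add: field_simps)
  qed
  then obtain c where c: "\<And>t. t \<in> {0..T} \<Longrightarrow> W t = c"
    using has_vector_derivative_zero_constant[of "{0..T}" W] by auto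
  have "W T = W 0" using c \<open>0 < T\<close> by simp
  then have "exp (- G T) = 1"
    using nz[of 0] \<open>0 < T\<close> closed by (simp add: W_def G_def)
  then obtain n :: int where n: "Im (G T) = 2 * pi * n"
    by (auto simp: exp_eq_1 dest: spec) (metis minus_equation_iff mult.commute mult_minus_right of_int_minus mult.assoc)
  have "integral {0..T} (\<lambda>t. Im (Z' t / Z t)) = Im (G T)"
    unfolding G_def
    using integral_linear[OF integrable_continuous_interval[OF contq] bounded_linear_Im]
    by (simp add: o_def)
  with n show ?thesis by auto
qed

text \<open>
  A form of Sturm's comparison theorem in which the parameter is arbitrary: with respect to the
  length \<open>d\<sigma> = a dt\<close> the system is \<open>f'' + (b / a) f = 0\<close>, and the hypothesis \<open>m\<^sup>2 b \<le> a\<close> compares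
  it with \<open>f'' + f / m\<^sup>2 = 0\<close>, whose solutions have period \<open>2 \<pi> m\<close>. The Pruefer angle of a closed
  solution grows by a positive multiple of \<open>2 \<pi>\<close>, and its rate \<open>\<omega>\<close> satisfies \<open>m \<omega> \<le> a\<close>.
\<close>

lemma periodic_solution_length:
  fixes f p a b :: "real \<Rightarrow> real"
  assumes T: "0 < T" and m: "0 < m"
    and f': "\<And>t. (f has_real_derivative a t * p t) (at t)"
    and p': "\<And>t. (p has_real_derivative - b t * f t) (at t)"
    and cont: "continuous_on UNIV a" "continuous_on UNIV b"
    and pos: "\<And>t. 0 < a t" "\<And>t. 0 < b t"
    and closed: "f T = f 0" "p T = p 0"
    and nontriv: "\<exists>t\<in>{0..T}. f t \<noteq> 0 \<or> p t \<noteq> 0"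
    and le: "\<And>t. m\<^sup>2 * b t \<le> a t"
  shows "2 * pi * m \<le> integral {0..T} a"
    and "\<exists>t\<in>{0..T}. m\<^sup>2 * b t < a t \<Longrightarrow> 2 * pi * m < integral {0..T} a"
proof -
  have nz: "f t \<noteq> 0 \<or> p t \<noteq> 0" if t: "t \<in> {0..T}" for t
  proof (rule ccontr)
    assume "\<not> (f t \<noteq> 0 \<or> p t \<noteq> 0)"
    then have "f 0 = 0 \<and> p 0 = 0"
      using linear_system_unique_forward[OF f' p' cont, of t T] t closed by simp
    then have "f s = 0 \<and> p s = 0" if "s \<in> {0..T}" for s
      using linear_system_unique_forward[OF f' p' cont, of 0 s] that by simp
    with nontriv show False by blast
  qed
  have contf: "continuous_on UNIV f" and contp: "continuous_on UNIV p"
    using f' p' by (auto intro!: DERIV_continuous_on simp: has_field_derivative_at_within)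
  define R where "R = (\<lambda>t. (m * p t)\<^sup>2 + (f t)\<^sup>2)"
  have Rpos: "0 < R t" if "t \<in> {0..T}" for t
    using nz[OF that] m by (auto simp: R_def sum_power2_gt_zero_iff)
  \<comment> \<open>the angular velocity of \<open>m p + i f\<close>\<close>
  define \<omega> where "\<omega> = (\<lambda>t. m * (a t * (p t)\<^sup>2 + b t * (f t)\<^sup>2) / R t)"
  define Z where "Z = (\<lambda>t. Complex (m * p t) (f t))"
  define Z' where "Z' = (\<lambda>t. Complex (m * (- b t * f t)) (a t * p t))"
  have contT: "continuous_on {0..T} a" "continuous_on {0..T} b" "continuous_on {0..T} f"
    "continuous_on {0..T} p"
    using cont contf contp continuous_on_subset by blast+
  have cont\<omega>: "continuous_on {0..T} \<omega>"
  proof -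
    have "continuous_on {0..T} R"
      unfolding R_def by (intro continuous_intros contT)
    then show ?thesis
      unfolding \<omega>_def using Rpos by (intro continuous_intros contT) force+
  qed
  have Im: "Im (Z' t / Z t) = \<omega> t" for t
    by (simp add: Z_def Z'_def \<omega>_def R_def Im_divide algebra_simps power2_eq_square)
  have "\<exists>n::int. integral {0..T} (\<lambda>t. Im (Z' t / Z t)) = 2 * pi * n"
  proof (rule closed_path_angle[OF T])
    show "(Z has_vector_derivative Z' t) (at t)" for t
      unfolding Z_def Z'_def has_vector_derivative_complex_iff
      using f'[of t] DERIV_cmult[OF p'[of t], of m] by simp
    show "continuous_on {0..T} Z'"
      unfolding Z'_def Complex_eq by (intro continuous_intros contT)
    show "Z t \<noteq> 0" if "t \<in> {0..T}" for t
      using nz[OF that] m by (auto simp: Z_def complex_eq_iff)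
    show "Z T = Z 0"
      by (simp add: Z_def closed)
  qed
  then obtain n :: int where n: "integral {0..T} \<omega> = 2 * pi * n"
    by (auto simp: Im)
  have \<omega>pos: "0 < \<omega> t" if t: "t \<in> {0..T}" for t
  proof -
    have "0 < a t * (p t)\<^sup>2 + b t * (f t)\<^sup>2"
      using nz[OF t] pos[of t] by (auto intro: add_pos_nonneg add_nonneg_pos)
    then show ?thesis
      using Rpos[OF t] m by (simp add: \<omega>_def)
  qed
  have gap: "a t - m * \<omega> t = (a t - m\<^sup>2 * b t) * (f t)\<^sup>2 / R t" if "t \<in> {0..T}" for t
    using Rpos[OF that] by (simp add: \<omega>_def field_simps) (simp add: R_def algebra_simps power2_eq_square)
  have gap0: "0 \<le> a t - m * \<omega> t" if "t \<in> {0..T}" for t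
    unfolding gap[OF that] using le[of t] Rpos[OF that] by simp
  have "integral {0..T} \<omega> \<noteq> 0"
  proof
    assume "integral {0..T} \<omega> = 0"
    then have "\<forall>t\<in>{0..T}. \<omega> t = 0"
      using integral_eq_0_iff[OF cont\<omega> T] \<omega>pos less_imp_le by blast
    then show False
      using \<omega>pos[of 0] T by simp
  qed
  moreover have "0 \<le> integral {0..T} \<omega>"
    using \<omega>pos by (intro integral_nonneg integrable_continuous_interval cont\<omega>) (auto intro: less_imp_le)
  ultimately have "0 < 2 * pi * n"
    using n by linarith
  then have "1 \<le> real_of_int n"
    by (simp add: zero_less_mult_iff)
  then have angle: "2 * pi \<le> integral {0..T} \<omega>"
    unfolding n by simp
  have contgap: "continuous_on {0..T} (\<lambda>t. a t - m * \<omega> t)"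
    by (intro continuous_intros contT cont\<omega>)
  have split: "integral {0..T} a = m * integral {0..T} \<omega> + integral {0..T} (\<lambda>t. a t - m * \<omega> t)"
    by (subst integral_diff) (auto intro!: integrable_continuous_interval contT cont\<omega> continuous_intros)
  have ge: "2 * pi * m \<le> m * integral {0..T} \<omega>"
    using mult_left_mono[OF angle, of m] m by (simp add: mult.commute)
  have gapint: "0 \<le> integral {0..T} (\<lambda>t. a t - m * \<omega> t)"
    using gap0 by (intro integral_nonneg integrable_continuous_interval contgap)
  show "2 * pi * m \<le> integral {0..T} a"
    using split ge gapint by linarith
  \<comment> \<open>If the bound is attained, \<open>f\<close> vanishes on the set where \<open>m\<^sup>2 b < a\<close>; that set is open,
    so \<open>f\<close> has zero derivative there and \<open>p\<close> vanishes too.\<close>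
  assume strict: "\<exists>t\<in>{0..T}. m\<^sup>2 * b t < a t"
  have "integral {0..T} (\<lambda>t. a t - m * \<omega> t) \<noteq> 0"
  proof
    assume "integral {0..T} (\<lambda>t. a t - m * \<omega> t) = 0"
    then have "\<forall>t\<in>{0..T}. a t - m * \<omega> t = 0"
      using integral_eq_0_iff[OF contgap T] gap0 by blast
    then have f0: "f t = 0" if "t \<in> {0..T}" "m\<^sup>2 * b t < a t" for t
      using gap[OF that(1)] that Rpos[OF that(1)] by force
    define U where "U = {0<..<T} \<inter> {t. m\<^sup>2 * b t < a t}"
    have "open U"
      unfolding U_def by (intro open_Int open_Collect_less continuous_intros cont)
    \<comment> \<open>The given point of strictness may be an endpoint; continuity moves it into the interior.\<close>
    have "U \<noteq> {}"
    proof
      assume "U = {}"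
      then have inner: "a t - m\<^sup>2 * b t \<le> 0" if "t \<in> {0<..<T}" for t
        using that by (force simp: U_def not_less)
      have "a t - m\<^sup>2 * b t \<le> 0" if "t \<in> {0..T}" for t
      proof (rule continuous_le_on_closure[of "{0<..<T}" "\<lambda>t. a t - m\<^sup>2 * b t"])
        show "continuous_on (closure {0<..<T}) (\<lambda>t. a t - m\<^sup>2 * b t)"
          unfolding closure_greaterThanLessThan[OF T] by (intro continuous_intros contT)
      qed (use that T inner in auto)
      with strict show False by force
    qed
    then obtain t where t: "t \<in> U" by blast
    have "((\<lambda>t. 0) has_real_derivative 0) (at t)"
      by simp
    then have "(f has_real_derivative 0) (at t)"
      by (rule has_field_derivative_transform_within_open[OF _ \<open>open U\<close> t])
         (auto simp: U_def f0)
    then have "p t = 0"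
      using DERIV_unique[OF f'[of t], of 0] pos(1)[of t] by simp
    moreover have "f t = 0" "t \<in> {0..T}"
      using t f0 by (auto simp: U_def)
    ultimately show False
      using nz by blast
  qed
  then show "2 * pi * m < integral {0..T} a"
    using split ge gapint by linarith
qed

section \<open>The profile curve of a self-shrinker\<close>

text \<open>
  The hypothesis \<open>shrinker\<close> is the equation \<open>H = h / 2\<close> for the surface of revolution with this
  profile, up to sign. Let \<open>k\<close> be the curvature of the profile and \<open>q\<close> the inner product of position
  and velocity. Rotation of the normal gives \<open>h' = - q k\<close>, and \<open>E' = E (r' / r - q / 2)\<close>.
  Substituting \<open>k = - z' / (r v) - h / 2\<close> cancels the two terms \<open>q h / 2\<close> in \<open>(E h)'\<close>; what is left is
  \<open>r' h v + q z'\<close> divided by \<open>r v\<close>, and this numerator is \<open>z v\<^sup>2\<close>, because it writes the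
  \<open>z\<close>-coordinate of the position vector in terms of its tangential and normal parts.
\<close>

lemma shrinker_profile_system:
  fixes r z r1 z1 :: "real \<Rightarrow> real" and r2 z2 t :: real
  defines "v \<equiv> \<lambda>t. sqrt ((r1 t)\<^sup>2 + (z1 t)\<^sup>2)"
  defines "E \<equiv> \<lambda>t. r t * exp (- ((r t)\<^sup>2 + (z t)\<^sup>2) / 4)"
  defines "h \<equiv> \<lambda>t. (z t * r1 t - r t * z1 t) / v t"
  assumes r: "(r has_real_derivative r1 t) (at t)" and z: "(z has_real_derivative z1 t) (at t)"
    and r1: "(r1 has_real_derivative r2) (at t)" and z1: "(z1 has_real_derivative z2) (at t)"
    and rpos: "0 < r t" and vpos: "0 < v t"
    and shrinker: "(r1 t * z2 - z1 t * r2) / (v t)^3 + z1 t / (r t * v t) = - h t / 2"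
  shows "((\<lambda>t. E t * h t) has_real_derivative E t * v t * (z t / r t)) (at t)"
    and "((\<lambda>t. z t / r t) has_real_derivative - (v t / (E t * (r t)\<^sup>2)) * (E t * h t)) (at t)"
proof -
  have Epos: "0 < E t" using rpos by (simp add: E_def)
  have vsq: "(v t)\<^sup>2 = (r1 t)\<^sup>2 + (z1 t)\<^sup>2"
    by (simp add: v_def)
  have sqpos: "0 < (r1 t)\<^sup>2 + (z1 t)\<^sup>2"
    using vpos by (simp add: v_def)
  \<comment> \<open>\<open>q\<close> is half the derivative of \<open>r\<^sup>2 + z\<^sup>2\<close>, and \<open>k\<close> is the curvature of the profile.\<close>
  define q where "q = r t * r1 t + z t * z1 t"
  define k where "k = (r1 t * z2 - z1 t * r2) / (v t)^3"
  have v': "(v has_real_derivative (r1 t * r2 + z1 t * z2) / v t) (at t)"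
    unfolding v_def using sqpos
    by (auto intro!: derivative_eq_intros r1 z1 simp: divide_simps)
  have E': "(E has_real_derivative E t * (r1 t / r t - q / 2)) (at t)"
    unfolding E_def q_def using rpos
    by (auto intro!: derivative_eq_intros r z simp: field_simps power2_eq_square)
  have h': "(h has_real_derivative - q * k) (at t)"
  proof -
    have "(h has_real_derivative
       ((z t * r2 - r t * z2) * v t - (z t * r1 t - r t * z1 t) * ((r1 t * r2 + z1 t * z2) / v t)) / (v t * v t)) (at t)"
      unfolding h_def using vpos
      by (auto intro!: derivative_eq_intros r z r1 z1 v' simp: algebra_simps)
    also have "((z t * r2 - r t * z2) * v t - (z t * r1 t - r t * z1 t) * ((r1 t * r2 + z1 t * z2) / v t)) / (v t * v t)
       = ((z t * r2 - r t * z2) * (v t)\<^sup>2 - (z t * r1 t - r t * z1 t) * (r1 t * r2 + z1 t * z2)) / (v t)^3"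
      using vpos by (simp add: field_simps power2_eq_square power3_eq_cube)
    also have "\<dots> = - q * k"
      unfolding vsq k_def q_def by (simp add: algebra_simps power2_eq_square)
    finally show ?thesis .
  qed
  have k: "k = - z1 t / (r t * v t) - h t / 2"
    using shrinker by (simp add: k_def)
  have "((\<lambda>t. E t * h t) has_real_derivative E t * (r1 t / r t - q / 2) * h t + (- q * k) * E t) (at t)"
    by (rule DERIV_mult[OF E' h'])
  also have "E t * (r1 t / r t - q / 2) * h t + (- q * k) * E t
     = E t * (r1 t * h t * v t + q * z1 t) / (r t * v t)"
    unfolding k using rpos vpos by (simp add: field_simps)
  also have "r1 t * h t * v t + q * z1 t = z t * (v t)\<^sup>2"
  proof -
    have "h t * v t = z t * r1 t - r t * z1 t"
      using vpos by (simp add: h_def)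
    then show ?thesis
      unfolding vsq q_def by algebra
  qed
  finally show "((\<lambda>t. E t * h t) has_real_derivative E t * v t * (z t / r t)) (at t)"
    using vpos by (simp add: power2_eq_square mult_ac)
  have "((\<lambda>t. z t / r t) has_real_derivative (z1 t * r t - z t * r1 t) / (r t)\<^sup>2) (at t)"
    using DERIV_divide[OF z r] rpos by (simp add: power2_eq_square)
  also have "(z1 t * r t - z t * r1 t) / (r t)\<^sup>2 = - (v t / (E t * (r t)\<^sup>2)) * (E t * h t)"
    using rpos vpos Epos by (simp add: h_def field_simps)
  finally show "((\<lambda>t. z t / r t) has_real_derivative - (v t / (E t * (r t)\<^sup>2)) * (E t * h t)) (at t)" .
qed

section \<open>Surfaces of revolution\<close>

lemma has_vector_derivative_vector3:
  assumes "(f has_real_derivative f') (at t)" "(g has_real_derivative g') (at t)"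
    "(h has_real_derivative h') (at t)"
  shows "((\<lambda>t. vector [f t, g t, h t] :: real^3) has_vector_derivative vector [f', g', h']) (at t)"
proof -
  have e: "vector [x, y, u] = x *\<^sub>R axis 1 1 + y *\<^sub>R axis 2 1 + u *\<^sub>R (axis 3 1 :: real^3)" for x y u :: real
    by (simp add: vec_eq_iff forall_3 axis_def)
  show ?thesis
    unfolding e using assms[unfolded has_real_derivative_iff_has_vector_derivative]
    by (auto intro!: derivative_eq_intros simp: has_real_derivative_iff_has_vector_derivative)
qed

lemma circle_inner:
  fixes x y \<theta> :: real
  shows "x * cos \<theta> * (y * cos \<theta>) + x * sin \<theta> * (y * sin \<theta>) = x * y"
  using sin_cos_squared_add[of \<theta>] by algebra

lemma partial_deriv_meridian:
  assumes "(\<gamma> has_vector_derivative \<gamma>' t) (at t)"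
  shows "partial_deriv 1 (revolution \<gamma>) (t, \<theta>) =
    vector [fst (\<gamma>' t) * cos \<theta>, fst (\<gamma>' t) * sin \<theta>, snd (\<gamma>' t)]"
proof -
  have s: "(\<gamma> \<circ> (\<lambda>s. t + s) has_vector_derivative 1 *\<^sub>R \<gamma>' t) (at 0)"
    by (rule vector_diff_chain_at) (use assms in \<open>auto intro!: derivative_eq_intros\<close>)
  have d: "((\<lambda>s. fst (\<gamma> (t + s))) has_real_derivative fst (\<gamma>' t)) (at 0)"
       "((\<lambda>s. snd (\<gamma> (t + s))) has_real_derivative snd (\<gamma>' t)) (at 0)"
    using bounded_linear.has_vector_derivative[OF bounded_linear_fst s]
      bounded_linear.has_vector_derivative[OF bounded_linear_snd s]
    by (simp_all add: has_real_derivative_iff_has_vector_derivative o_def)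
  show ?thesis
    unfolding partial_deriv_def coord_dir_def revolution_def
    by (rule vector_derivative_at)
       (auto intro!: has_vector_derivative_vector3 derivative_eq_intros d)
qed

lemma partial_deriv_parallel:
  "partial_deriv 2 (revolution \<gamma>) (t, \<theta>) = vector [- fst (\<gamma> t) * sin \<theta>, fst (\<gamma> t) * cos \<theta>, 0]"
  unfolding partial_deriv_def coord_dir_def revolution_def
  by (rule vector_derivative_at)
     (auto intro!: has_vector_derivative_vector3 derivative_eq_intros)

lemma partial_deriv_parallel_twice:
  "partial_deriv 2 (partial_deriv 2 (revolution \<gamma>)) (t, \<theta>) =
     vector [- fst (\<gamma> t) * cos \<theta>, - fst (\<gamma> t) * sin \<theta>, 0]"
proof -
  have "((\<lambda>s. partial_deriv 2 (revolution \<gamma>) (t, \<theta> + s)) has_vector_derivative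
      vector [- fst (\<gamma> t) * cos \<theta>, - fst (\<gamma> t) * sin \<theta>, 0]) (at 0)"
    unfolding partial_deriv_parallel
    by (auto intro!: has_vector_derivative_vector3 derivative_eq_intros)
  then show ?thesis
    unfolding partial_deriv_def[of 2 "partial_deriv 2 _"]
    by (intro vector_derivative_at) (simp add: coord_dir_def)
qed

lemma first_fundamental_form_revolution:
  fixes \<theta> :: real
  assumes "(\<gamma> has_vector_derivative \<gamma>' t) (at t)"
  defines "g \<equiv> first_fundamental_form (revolution \<gamma>) (t, \<theta>)"
  shows "g $ 1 $ 1 = (norm (\<gamma>' t))\<^sup>2" "g $ 2 $ 2 = (fst (\<gamma> t))\<^sup>2" "g $ 1 $ 2 = 0" "g $ 2 $ 1 = 0"
proof -
  have n: "(norm (\<gamma>' t))\<^sup>2 = (fst (\<gamma>' t))\<^sup>2 + (snd (\<gamma>' t))\<^sup>2"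
    by (simp add: norm_prod_def)
  show "g $ 1 $ 1 = (norm (\<gamma>' t))\<^sup>2"
    using circle_inner[of "fst (\<gamma>' t)" \<theta> "fst (\<gamma>' t)"] unfolding n
    by (simp add: g_def first_fundamental_form_def partial_deriv_meridian[of \<gamma> \<gamma>', OF assms(1)]
        inner_vec_def sum_3 power2_eq_square)
  show "g $ 2 $ 2 = (fst (\<gamma> t))\<^sup>2"
    using circle_inner[of "fst (\<gamma> t)" \<theta> "fst (\<gamma> t)"]
    by (simp add: g_def first_fundamental_form_def partial_deriv_parallel inner_vec_def sum_3
        power2_eq_square)
  show "g $ 1 $ 2 = 0" "g $ 2 $ 1 = 0"
    by (simp_all add: g_def first_fundamental_form_def partial_deriv_parallel
        partial_deriv_meridian[of \<gamma> \<gamma>', OF assms(1)] inner_vec_def sum_3)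
qed

lemma unit_normal_revolution:
  assumes "(\<gamma> has_vector_derivative \<gamma>' t) (at t)" and "0 < fst (\<gamma> t)"
  shows "unit_normal (revolution \<gamma>) (t, \<theta>) =
    (1 / norm (\<gamma>' t)) *\<^sub>R vector [- snd (\<gamma>' t) * cos \<theta>, - snd (\<gamma>' t) * sin \<theta>, fst (\<gamma>' t)]"
proof -
  define n :: "real^3" where
    "n = vector [- snd (\<gamma>' t) * cos \<theta>, - snd (\<gamma>' t) * sin \<theta>, fst (\<gamma>' t)]"
  have cross: "cross3 (partial_deriv 1 (revolution \<gamma>) (t, \<theta>)) (partial_deriv 2 (revolution \<gamma>) (t, \<theta>))
      = fst (\<gamma> t) *\<^sub>R n"
    using circle_inner[of "fst (\<gamma>' t)" \<theta> "fst (\<gamma> t)"]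
    by (simp add: partial_deriv_meridian[of \<gamma> \<gamma>', OF assms(1)] partial_deriv_parallel
        n_def cross3_def vec_eq_iff forall_3 algebra_simps)
  have "norm n = norm (\<gamma>' t)"
    using circle_inner[of "snd (\<gamma>' t)" \<theta> "snd (\<gamma>' t)"]
    by (simp add: n_def norm_eq_sqrt_inner inner_vec_def sum_3 inner_prod_def)
  then show ?thesis
    unfolding unit_normal_def cross using assms(2)
    unfolding n_def[symmetric] by (simp add: sgn_scaleR sgn_div_norm[of n] divide_inverse)
qed

lemma trace_matrix_inv_diagonal:
  fixes g A :: "real^2^2"
  assumes "g $ 1 $ 2 = 0" "g $ 2 $ 1 = 0" "g $ 1 $ 1 \<noteq> 0" "g $ 2 $ 2 \<noteq> 0"
  shows "trace (matrix_inv g ** A) = A $ 1 $ 1 / g $ 1 $ 1 + A $ 2 $ 2 / g $ 2 $ 2"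
proof -
  define d :: "real^2^2" where "d = (\<chi> i j. if i = j then 1 / g $ i $ i else 0)"
  have d: "g ** d = mat 1" "d ** g = mat 1"
    using assms by (simp_all add: d_def matrix_matrix_mult_def mat_def vec_eq_iff forall_2 sum_2)
  have "g ** matrix_inv g = mat 1 \<and> matrix_inv g ** g = mat 1"
    unfolding matrix_inv_def by (rule someI[of _ d]) (simp add: d)
  then have "matrix_inv g = d"
    by (metis d(1) matrix_mul_assoc matrix_mul_lid matrix_mul_rid)
  then show ?thesis
    by (simp add: d_def trace_def matrix_matrix_mult_def sum_2)
qed

text \<open>
  The metric is diagonal, so the trace is the sum of the two principal curvatures: the curvature of the
  profile and the curvature \<open>z' / (r v)\<close> in the direction of the parallel circle.
\<close>

lemma mean_curvature_revolution:
  assumes d1: "\<And>s. (\<gamma> has_vector_derivative \<gamma>' s) (at s)"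
    and d2: "(\<gamma>' has_vector_derivative \<gamma>'') (at t)"
    and pos: "0 < fst (\<gamma> t)" and nz: "\<gamma>' t \<noteq> 0"
  shows "mean_curvature (revolution \<gamma>) (t, \<theta>) =
    - ((fst (\<gamma>' t) * snd \<gamma>'' - snd (\<gamma>' t) * fst \<gamma>'') / (norm (\<gamma>' t))^3
       + snd (\<gamma>' t) / (fst (\<gamma> t) * norm (\<gamma>' t)))"
proof -
  have pd1: "partial_deriv 1 (revolution \<gamma>) = revolution \<gamma>'"
  proof
    fix p show "partial_deriv 1 (revolution \<gamma>) p = revolution \<gamma>' p"
      using partial_deriv_meridian[of \<gamma> \<gamma>', OF d1, of "fst p" "snd p"]
      by (simp add: revolution_def case_prod_beta)
  qed
  have pd11: "partial_deriv 1 (revolution \<gamma>') (t, \<theta>) =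
      vector [fst \<gamma>'' * cos \<theta>, fst \<gamma>'' * sin \<theta>, snd \<gamma>'']"
    by (rule partial_deriv_meridian) (rule d2)
  let ?A = "second_fundamental_form (revolution \<gamma>) (t, \<theta>)"
  have A11: "?A $ 1 $ 1 = (fst (\<gamma>' t) * snd \<gamma>'' - snd (\<gamma>' t) * fst \<gamma>'') / norm (\<gamma>' t)"
    using circle_inner[of "fst \<gamma>''" \<theta> "snd (\<gamma>' t)"]
    by (simp add: second_fundamental_form_def pd1 pd11 unit_normal_revolution[of \<gamma> \<gamma>', OF d1 pos]
        inner_vec_def sum_3 algebra_simps diff_divide_distrib flip: add_divide_distrib)
  have A22: "?A $ 2 $ 2 = fst (\<gamma> t) * snd (\<gamma>' t) / norm (\<gamma>' t)"
    using circle_inner[of "fst (\<gamma> t)" \<theta> "snd (\<gamma>' t)"]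
    by (simp add: second_fundamental_form_def partial_deriv_parallel_twice
        unit_normal_revolution[of \<gamma> \<gamma>', OF d1 pos]
        inner_vec_def sum_3 flip: add_divide_distrib)
  note g = first_fundamental_form_revolution[of \<gamma> \<gamma>', OF d1]
  show ?thesis
    unfolding mean_curvature_def
    using pos nz
    by (subst trace_matrix_inv_diagonal)
       (simp_all add: g A11 A22 power2_eq_square power3_eq_cube mult_ac)
qed

lemma support_function_revolution:
  assumes "(\<gamma> has_vector_derivative \<gamma>' t) (at t)" and "0 < fst (\<gamma> t)"
  shows "revolution \<gamma> (t, \<theta>) \<bullet> unit_normal (revolution \<gamma>) (t, \<theta>) =
    (snd (\<gamma> t) * fst (\<gamma>' t) - fst (\<gamma> t) * snd (\<gamma>' t)) / norm (\<gamma>' t)"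
proof -
  show ?thesis
    using circle_inner[of "fst (\<gamma> t)" \<theta> "snd (\<gamma>' t)"]
    unfolding unit_normal_revolution[of \<gamma> \<gamma>', OF assms]
    by (simp add: revolution_def inner_vec_def sum_3 diff_divide_distrib)
      (simp add: algebra_simps flip: add_divide_distrib)
qed

lemma norm_revolution: "(norm (revolution \<gamma> (t, \<theta>)))\<^sup>2 = (fst (\<gamma> t))\<^sup>2 + (snd (\<gamma> t))\<^sup>2"
  using circle_inner[of "fst (\<gamma> t)" \<theta> "fst (\<gamma> t)"]
  by (simp add: revolution_def power2_norm_eq_inner inner_vec_def sum_3)
     (simp add: power2_eq_square)

lemma axis_dist_revolution: "(axis_dist (revolution \<gamma> (t, \<theta>)))\<^sup>2 = (fst (\<gamma> t))\<^sup>2"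
  using circle_inner[of "fst (\<gamma> t)" \<theta> "fst (\<gamma> t)"]
  by (simp add: revolution_def axis_dist_def power2_eq_square)

lemma F_functional_revolution:
  assumes d: "\<And>s. (\<gamma> has_vector_derivative \<gamma>' s) (at s)"
    and cont: "continuous_on UNIV \<gamma>'" and pos: "\<And>t. 0 < fst (\<gamma> t)"
  shows "F_functional (torus_domain T) (revolution \<gamma>) = 1 / 2 *
    integral {0..T} (\<lambda>t. fst (\<gamma> t) * exp (- ((fst (\<gamma> t))\<^sup>2 + (snd (\<gamma> t))\<^sup>2) / 4) * norm (\<gamma>' t))"
proof -
  define a where
    "a = (\<lambda>t. fst (\<gamma> t) * exp (- ((fst (\<gamma> t))\<^sup>2 + (snd (\<gamma> t))\<^sup>2) / 4) * norm (\<gamma>' t))"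
  have \<gamma>: "continuous_on UNIV \<gamma>"
    using d by (rule has_vector_derivative_imp_continuous_on)
  have conta: "continuous_on UNIV a"
    unfolding a_def by (intro continuous_intros \<gamma> cont) auto
  have "exp (- (norm (revolution \<gamma> p))\<^sup>2 / 4) * sqrt (det (first_fundamental_form (revolution \<gamma>) p))
      = a (fst p)" for p
  proof -
    obtain t \<theta> where p: "p = (t, \<theta>)" by fastforce
    have "det (first_fundamental_form (revolution \<gamma>) p) = (norm (\<gamma>' t) * fst (\<gamma> t))\<^sup>2"
      unfolding p det_2 first_fundamental_form_revolution[of \<gamma> \<gamma>', OF d]
      by (simp add: power_mult_distrib)
    then show ?thesis
      using pos[of t] unfolding p norm_revolution by (simp add: a_def)
  qed
  then have "F_functional (torus_domain T) (revolution \<gamma>) =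
      1 / (4 * pi) * integral (cbox (0, 0) (T, 2 * pi)) (\<lambda>p. a (fst p))"
    by (simp add: F_functional_def torus_domain_def cbox_Pair_eq)
  also have "integral (cbox (0, 0) (T, 2 * pi)) (\<lambda>p. a (fst p)) = 2 * pi * integral {0..T} a"
    by (subst integral_prod_continuous)
       (auto intro!: continuous_on_compose2[OF conta] continuous_intros)
  finally show ?thesis
    by (simp add: a_def)
qed

text \<open>
  The translation \<open>0\<close> and the scale \<open>1\<close> compete in the supremum; this passes the lower bound from
  \<open>F\<close> to the entropy.
\<close>

lemma F_functional_le_entropy: "ereal (F_functional D X) \<le> entropy D X"
proof -
  have "ereal (F_functional D (\<lambda>p. 0 + sqrt 1 *\<^sub>R X p)) \<le> entropy D X"
    unfolding entropy_def
    using SUP_upper[of "(0, 1)" "UNIV \<times> {0<..}" "\<lambda>(x\<^sub>0, t\<^sub>0). ereal (F_functional D (\<lambda>p. x\<^sub>0 + sqrt t\<^sub>0 *\<^sub>R X p))"]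
    by simp
  then show ?thesis by simp
qed

section \<open>The entropy bound\<close>

lemma periodic_representative:
  fixes \<gamma> :: "real \<Rightarrow> 'a"
  assumes "0 < T" and "\<And>t. \<gamma> (t + T) = \<gamma> t"
  shows "\<exists>s\<in>{0..T}. \<gamma> s = \<gamma> t"
proof -
  have n: "\<gamma> (t + real n * T) = \<gamma> t" for n t
  proof (induction n)
    case (Suc n)
    then show ?case
      using assms(2)[of "t + real n * T"] by (simp add: algebra_simps)
  qed simp
  have k: "\<gamma> (t + of_int k * T) = \<gamma> t" for k t
  proof (cases "0 \<le> k")
    case True
    then show ?thesis using n[of t "nat k"] by simp
  next
    case False
    then show ?thesis using n[of "t + of_int k * T" "nat (- k)"] by (simp add: algebra_simps)
  qed
  have "of_int \<lfloor>t / T\<rfloor> * T \<le> t" "t \<le> (of_int \<lfloor>t / T\<rfloor> + 1) * T"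
    using \<open>0 < T\<close> of_int_floor_le[of "t / T"] less_imp_le[OF floor_correct[of "t / T", THEN conjunct2]]
    by (simp_all only: pos_le_divide_eq pos_divide_le_eq of_int_add of_int_1)
  then show ?thesis
    using k[of t "- \<lfloor>t / T\<rfloor>"] by (intro bexI[of _ "t + of_int (- \<lfloor>t / T\<rfloor>) * T"]) (simp_all add: algebra_simps)
qed

text \<open>
  The comparison theorem is applied with \<open>a = E v\<close> and \<open>b = v / (E r\<^sup>2)\<close>, for which
  \<open>m\<^sup>2 b \<le> a\<close> means \<open>m \<le> E r\<close>, that is, \<open>m \<le> W\<close>. The solution is nontrivial: if \<open>z / r\<close>
  vanished identically, the profile would be a closed curve immersed in a line.
\<close>

lemma closed_shrinker_profile_bound:
  fixes \<gamma> :: "real \<Rightarrow> real \<times> real"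
  defines "W \<equiv> \<lambda>t. (fst (\<gamma> t))\<^sup>2 * exp (- ((fst (\<gamma> t))\<^sup>2 + (snd (\<gamma> t))\<^sup>2) / 4)"
  assumes closed: "immersed_closed_curve \<gamma> T"
    and pos: "\<And>t. 0 < fst (\<gamma> t)"
    and shrinker: "self_shrinker (revolution \<gamma>)"
    and m: "0 < m" "\<And>t. m \<le> W t"
  shows "pi * m \<le> F_functional (torus_domain T) (revolution \<gamma>)"
    and "\<exists>t. m < W t \<Longrightarrow> pi * m < F_functional (torus_domain T) (revolution \<gamma>)"
proof -
  define \<gamma>1 where "\<gamma>1 = (\<lambda>t. vector_derivative \<gamma> (at t))"
  define \<gamma>2 where "\<gamma>2 = (\<lambda>t. vector_derivative \<gamma>1 (at t))"
  have T: "0 < T" and per: "\<And>t. \<gamma> (t + T) = \<gamma> t" and nz: "\<And>t. \<gamma>1 t \<noteq> 0"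
    and smooth: "smooth_curve \<gamma>"
    using closed by (auto simp: immersed_closed_curve_def \<gamma>1_def)
  have smooth': "((\<lambda>f s. vector_derivative f (at s)) ^^ n) \<gamma> differentiable at t" for n t
    using smooth unfolding smooth_curve_def by blast
  have d1: "(\<gamma> has_vector_derivative \<gamma>1 t) (at t)" for t
    using smooth'[of 0] by (simp add: \<gamma>1_def flip: vector_derivative_works)
  have d2: "(\<gamma>1 has_vector_derivative \<gamma>2 t) (at t)" for t
    using smooth'[of 1] by (simp add: \<gamma>2_def \<gamma>1_def flip: vector_derivative_works)
  have per1: "\<gamma>1 T = \<gamma>1 0"
  proof -
    have "(\<gamma> \<circ> (\<lambda>t. t + T) has_vector_derivative 1 *\<^sub>R \<gamma>1 T) (at 0)"
      by (rule vector_diff_chain_at) (use d1[of T] in \<open>auto intro!: derivative_eq_intros\<close>)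
    moreover have "\<gamma> \<circ> (\<lambda>t. t + T) = \<gamma>"
      using per by auto
    ultimately show ?thesis
      using vector_derivative_unique_at[OF d1[of 0]] by simp
  qed
  define r z r1 z1 r2 z2 where "r = (\<lambda>t. fst (\<gamma> t))" and "z = (\<lambda>t. snd (\<gamma> t))"
    and "r1 = (\<lambda>t. fst (\<gamma>1 t))" and "z1 = (\<lambda>t. snd (\<gamma>1 t))"
    and "r2 = (\<lambda>t. fst (\<gamma>2 t))" and "z2 = (\<lambda>t. snd (\<gamma>2 t))"
  note coords = r_def z_def r1_def z1_def r2_def z2_def
  define v where "v = (\<lambda>t. sqrt ((r1 t)\<^sup>2 + (z1 t)\<^sup>2))"
  define E where "E = (\<lambda>t. r t * exp (- ((r t)\<^sup>2 + (z t)\<^sup>2) / 4))"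
  define h where "h = (\<lambda>t. (z t * r1 t - r t * z1 t) / v t)"
  have rd: "(r has_real_derivative r1 t) (at t)" and zd: "(z has_real_derivative z1 t) (at t)"
    and r1d: "(r1 has_real_derivative r2 t) (at t)" and z1d: "(z1 has_real_derivative z2 t) (at t)" for t
    using bounded_linear.has_vector_derivative[OF bounded_linear_fst d1]
      bounded_linear.has_vector_derivative[OF bounded_linear_snd d1]
      bounded_linear.has_vector_derivative[OF bounded_linear_fst d2]
      bounded_linear.has_vector_derivative[OF bounded_linear_snd d2]
    by (simp_all add: has_real_derivative_iff_has_vector_derivative coords)
  have v_norm: "v t = norm (\<gamma>1 t)" for t
    by (simp add: v_def coords norm_prod_def)
  have rpos: "0 < r t" and Epos: "0 < E t" and vpos: "0 < v t" for t
    using pos nz by (simp_all add: r_def E_def v_norm)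
  have WE: "W t = E t * r t" for t
    by (simp add: W_def E_def coords power2_eq_square)
  have eq: "(r1 t * z2 t - z1 t * r2 t) / (v t)^3 + z1 t / (r t * v t) = - h t / 2" for t
    using shrinker[unfolded self_shrinker_def, rule_format, of "(t, 0)"]
    unfolding mean_curvature_revolution[of \<gamma> \<gamma>1, OF d1 d2 pos nz]
      support_function_revolution[of \<gamma> \<gamma>1, OF d1 pos]
    by (simp add: h_def v_norm coords)
  have system: "((\<lambda>t. E t * h t) has_real_derivative E t * v t * (z t / r t)) (at t)"
    "((\<lambda>t. z t / r t) has_real_derivative - (v t / (E t * (r t)\<^sup>2)) * (E t * h t)) (at t)" for t
    using shrinker_profile_system[OF rd zd r1d z1d rpos vpos[unfolded v_def] eq[unfolded h_def v_def]]
    unfolding E_def h_def v_def by blast+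
  have contr: "continuous_on UNIV r" "continuous_on UNIV z" "continuous_on UNIV r1" "continuous_on UNIV z1"
    using rd zd r1d z1d by (auto intro!: DERIV_continuous_on simp: has_field_derivative_at_within)
  have contv: "continuous_on UNIV v"
    unfolding v_def by (intro continuous_intros contr)
  have contE: "continuous_on UNIV E"
    unfolding E_def by (intro continuous_intros contr) auto
  define a b where "a = (\<lambda>t. E t * v t)" and "b = (\<lambda>t. v t / (E t * (r t)\<^sup>2))"
  have conta: "continuous_on UNIV a"
    unfolding a_def by (intro continuous_intros contE contv)
  have contb: "continuous_on UNIV b"
    unfolding b_def using Epos rpos
    by (intro continuous_intros contE contv contr) (simp add: less_imp_neq[symmetric])
  have ab_apply: "a t = E t * v t" "b t = v t / (E t * (r t)\<^sup>2)" for t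
    by (simp_all add: a_def b_def)
  have nontriv: "\<exists>t\<in>{0..T}. E t * h t \<noteq> 0 \<or> z t / r t \<noteq> 0"
  proof (rule ccontr)
    assume "\<not> ?thesis"
    then have "z t = 0" if "t \<in> {0..T}" for t
      using that rpos[of t] by auto
    then have "z t = 0" for t
      using periodic_representative[of T \<gamma>, OF T per, of t] unfolding z_def by metis
    then have "z = (\<lambda>t. 0)" by auto
    then have z10: "z1 t = 0" for t
      using DERIV_unique[OF zd[of t]] by simp
    have "\<exists>t. 0 < t \<and> t < T \<and> r1 t = 0"
    proof -
      have "r 0 = r T"
        using per[of 0] by (simp add: r_def)
      then obtain t where "0 < t" "t < T" "(r has_real_derivative 0) (at t)"
        using Rolle[OF T, of r] rd contr(1)
        by (metis continuous_on_subset real_differentiable_def subset_UNIV)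
      then show ?thesis
        using DERIV_unique[OF rd] by blast
    qed
    with z10 nz show False
      by (auto simp: coords prod_eq_iff)
  qed
  have ab: "a t - m\<^sup>2 * b t = v t / (E t * (r t)\<^sup>2) * ((W t)\<^sup>2 - m\<^sup>2)" for t
    using Epos[of t] rpos[of t] by (simp add: a_def b_def WE field_simps power2_eq_square)
  have factor: "0 < v t / (E t * (r t)\<^sup>2)" for t
    using Epos[of t] rpos[of t] vpos[of t] by simp
  have le: "m\<^sup>2 * b t \<le> a t" for t
  proof -
    have "0 \<le> (W t)\<^sup>2 - m\<^sup>2"
      using power_mono[OF m(2)[of t], of 2] m(1) by simp
    then have "0 \<le> a t - m\<^sup>2 * b t"
      unfolding ab using factor[of t] by (intro mult_nonneg_nonneg) auto
    then show ?thesis by simp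
  qed
  have apos: "0 < a t" and bpos: "0 < b t" for t
    using factor[of t] Epos[of t] vpos[of t] by (simp_all add: a_def b_def)
  have closed': "E T * h T = E 0 * h 0" "z T / r T = z 0 / r 0"
    using per[of 0] per1 by (simp_all add: E_def h_def v_def coords)
  note bound = periodic_solution_length[OF T m(1) system[folded ab_apply] conta contb apos bpos closed' nontriv le]
  have cont1: "continuous_on UNIV \<gamma>1"
    using d2 by (rule has_vector_derivative_imp_continuous_on)
  have F: "F_functional (torus_domain T) (revolution \<gamma>) = 1 / 2 * integral {0..T} a"
    unfolding F_functional_revolution[of \<gamma> \<gamma>1, OF d1 cont1 pos]
    by (simp add: a_def E_def v_norm coords)
  show "pi * m \<le> F_functional (torus_domain T) (revolution \<gamma>)"
    using bound(1) unfolding F by simp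
  assume "\<exists>t. m < W t"
  then obtain t where t: "t \<in> {0..T}" "m < W t"
    using periodic_representative[of T \<gamma>, OF T per] by (metis W_def)
  have "0 < (W t)\<^sup>2 - m\<^sup>2"
    using power_strict_mono[OF t(2), of 2] m(1) by simp
  then have "0 < a t - m\<^sup>2 * b t"
    unfolding ab using factor[of t] by (intro mult_pos_pos)
  then show "pi * m < F_functional (torus_domain T) (revolution \<gamma>)"
    using bound(2) t(1) unfolding F by force
qed

theorem theorem5p2:
  fixes \<gamma> :: "real \<Rightarrow> real \<times> real" and T :: real
  assumes "immersed_closed_curve \<gamma> T"
    and "\<forall>t. fst (\<gamma> t) > 0"
    and "self_shrinker (revolution \<gamma>)"
  shows "let X = revolution \<gamma>;
             \<Sigma> = range X;
             D = torus_domain T;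
             w = (\<lambda>x. (axis_dist x)\<^sup>2 * exp (- (norm x)\<^sup>2 / 4));
             m = (INF x\<in>\<Sigma>. w x)
         in entropy D X \<ge> ereal (pi * m) \<and> F_functional D X \<ge> pi * m \<and>
            (\<not> w constant_on \<Sigma> \<longrightarrow>
               entropy D X > ereal (pi * m) \<and> F_functional D X > pi * m)"
proof -
  define W where "W = (\<lambda>t. (fst (\<gamma> t))\<^sup>2 * exp (- ((fst (\<gamma> t))\<^sup>2 + (snd (\<gamma> t))\<^sup>2) / 4))"
  define w where "w = (\<lambda>x :: real^3. (axis_dist x)\<^sup>2 * exp (- (norm x)\<^sup>2 / 4))"
  define m where "m = (INF x\<in>range (revolution \<gamma>). w x)"
  define F where "F = F_functional (torus_domain T) (revolution \<gamma>)"
  have wW: "w (revolution \<gamma> (t, \<theta>)) = W t" for t \<theta>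
    by (simp only: w_def W_def norm_revolution axis_dist_revolution)
  have range: "w ` range (revolution \<gamma>) = range W"
  proof -
    have "w (revolution \<gamma> p) = W (fst p)" for p
      using wW[of "fst p" "snd p"] by simp
    then show ?thesis
      by (simp add: image_image image_def) (metis fst_conv)
  qed
  have pos: "\<And>t. 0 < fst (\<gamma> t)" and T: "0 < T" and per: "\<And>t. \<gamma> (t + T) = \<gamma> t"
    and smooth: "smooth_curve \<gamma>"
    using assms by (auto simp: immersed_closed_curve_def)
  have "\<gamma> differentiable at t" for t
    using smooth[unfolded smooth_curve_def, rule_format, of 0] by simp
  then have "continuous_on {0..T} \<gamma>"
    by (simp add: continuous_at_imp_continuous_on differentiable_imp_continuous_within)
  then have "continuous_on {0..T} W"
    unfolding W_def by (intro continuous_intros) auto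
  then obtain s where s: "\<And>t. t \<in> {0..T} \<Longrightarrow> W s \<le> W t"
    using continuous_attains_inf[of "{0..T}" W] T by fastforce
  have min: "W s \<le> W t" for t
    using periodic_representative[of T \<gamma>, OF T per, of t] s by (metis W_def)
  have m: "m = W s"
    unfolding m_def range using min by (intro cInf_eq_minimum) auto
  have mpos: "0 < m"
    unfolding m using pos[of s] by (simp add: W_def)
  have bound: "pi * m \<le> F" "\<exists>t. m < W t \<Longrightarrow> pi * m < F"
    using closed_shrinker_profile_bound[OF assms(1) pos assms(3) mpos] min
    unfolding m W_def F_def by simp_all
  have strict: "pi * m < F" if "\<not> w constant_on range (revolution \<gamma>)"
  proof (rule bound(2), rule ccontr)
    assume "\<nexists>t. m < W t"
    then have "W t = m" for t
      using min[of t] m by (simp add: not_less antisym)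
    then have "w constant_on range (revolution \<gamma>)"
      using wW by (auto simp: constant_on_def)
    with that show False by blast
  qed
  have "ereal F \<le> entropy (torus_domain T) (revolution \<gamma>)"
    unfolding F_def by (rule F_functional_le_entropy)
  then have "ereal (pi * m) \<le> entropy (torus_domain T) (revolution \<gamma>)"
    "pi * m < F \<Longrightarrow> ereal (pi * m) < entropy (torus_domain T) (revolution \<gamma>)"
    using bound(1) by (meson ereal_less_eq(3) order_trans less_ereal.simps(1) less_le_trans)+
  then show ?thesis
    using bound(1) strict
    unfolding Let_def w_def[symmetric] m_def[symmetric] F_def[symmetric] by blast
qed

end
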